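(* For a positive integer $k$, let $a_k$ denote the number of nonempty $\otimes$-irreducible partition diagrams in $A_k$. Then $a_1 = 2$ and, for every $k \geq 1$, $$a_k = B_{2k} - \sum_{\substack{\alpha \vDash k \\ \alpha \neq (k)}} a_{\alpha_1} a_{\alpha_2} \cdots a_{\alpha_{\ell(\alpha)}},$$ where the sum is over all integer compositions $\alpha=(\alpha_1,\dots,\alpha_{\ell(\alpha)})$ of $k$ other than $(k)$, and $B_m$ denotes the $m$-th Bell number (the number of set partitions of an $m$-element set).
   Context: For $k \geq 0$, a partition diagram of order $k$ is a set partition of $\{1,\ldots,k,1',\ldots,k'\}$; $A_k$ denotes the set of all such diagrams (so $|A_k| = B_{2k}$), and $A_0=\{\varnothing\}$. For $\pi \in A_k$ and $\rho \in A_l$, $\pi \otimes \rho \in A_{k+l}$ is the set partition whose blocks are the blocks of $\pi$ together with the blocks of $\rho$ with every $i$ replaced by $i+k$ and every $i'$ by $(i+k)'$. A diagram is $\otimes$-irreducible if it cannot be written as $\rho^{(1)} \otimes \rho^{(2)}$ with $\rho^{(1)},\rho^{(2)}$ nonempty (of positive order). *)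

theory Defs
  imports Main "HOL-Library.Disjoint_Sets"
begin

text \<open>The vertex \<open>i\<close> is \<open>Inl i\<close>, and the primed vertex \<open>i'\<close> is \<open>Inr i\<close>.\<close>

type_synonym diagram = "(nat + nat) set set"

definition diagrams :: "nat \<Rightarrow> diagram set" where
  "diagrams k = {\<pi>. partition_on ({1..k} <+> {1..k}) \<pi>}"

text \<open>A diagram determines its order, as its blocks cover exactly the vertices. The order
  \<open>k\<close> of the left factor is nevertheless an explicit argument, as it is the amount by which the
  right factor is shifted.\<close>

definition tensor :: "nat \<Rightarrow> diagram \<Rightarrow> diagram \<Rightarrow> diagram" where
  "tensor k \<pi> \<rho> = \<pi> \<union> (\<lambda>B. map_sum (\<lambda>i. i + k) (\<lambda>i. i + k) ` B) ` \<rho>"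

definition tensor_irreducible :: "diagram \<Rightarrow> bool" where
  "tensor_irreducible \<pi> \<longleftrightarrow>
    (\<nexists>m n \<rho>\<^sub>1 \<rho>\<^sub>2. 0 < m \<and> 0 < n \<and> \<rho>\<^sub>1 \<in> diagrams m \<and> \<rho>\<^sub>2 \<in> diagrams n \<and> \<pi> = tensor m \<rho>\<^sub>1 \<rho>\<^sub>2)"

definition num_irreducible :: "nat \<Rightarrow> nat" where
  "num_irreducible k = card {\<pi> \<in> diagrams k. \<pi> \<noteq> {} \<and> tensor_irreducible \<pi>}"

definition Bell :: "nat \<Rightarrow> nat" where
  "Bell m = card {P. partition_on {1..m} P}"

definition compositions :: "nat \<Rightarrow> nat list set" where
  "compositions k = {\<alpha>. (\<forall>i \<in> set \<alpha>. 0 < i) \<and> sum_list \<alpha> = k}"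

lemma finite_diagrams: "finite (diagrams k)"
  unfolding diagrams_def by (rule finitely_many_partition_on) simp

lemma diagrams_0: "diagrams 0 = {{}}"
proof -
  have "({1..0::nat} <+> {1..0::nat}) = {}"
    by (simp add: Plus_def)
  then show ?thesis
    by (simp only: diagrams_def partition_on_empty singleton_conv)
qed

lemma tensor_in_diagrams:
  assumes "\<pi> \<in> diagrams k" and "\<rho> \<in> diagrams l"
  shows "tensor k \<pi> \<rho> \<in> diagrams (k + l)"
proof -
  let ?s = "map_sum (\<lambda>i. i + k) (\<lambda>i. i + k)"
  let ?R = "{k+1..k+l} <+> {k+1..k+l}"
  have inj: "inj ?s"
    by (intro sum.inj_map) (simp_all add: inj_def)
  have img: "?s ` ({1..l} <+> {1..l}) = ?R"
  proof -
    have sh: "(\<lambda>i. i + k) ` {1..l} = {k+1..k+l}"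
      by (simp add: add.commute)
    have "?s ` ({1..l} <+> {1..l}) = (\<lambda>i. i + k) ` {1..l} <+> (\<lambda>i. i + k) ` {1..l}"
      by (simp only: Plus_def image_Un image_image map_sum.simps)
    then show ?thesis
      by (simp only: sh)
  qed
  have "partition_on ?R ((`) ?s ` \<rho> - {{}})"
    using partition_on_inj_image[OF _ inj_on_subset[OF inj subset_UNIV],
        of "{1..l} <+> {1..l}" \<rho>] assms(2) unfolding img diagrams_def by blast
  moreover have "{} \<notin> (`) ?s ` \<rho>"
    using assms(2) by (auto simp: diagrams_def partition_on_def)
  ultimately have R: "partition_on ?R ((`) ?s ` \<rho>)"
    by simp
  have L: "partition_on ({1..k} <+> {1..k}) \<pi>"
    using assms(1) by (simp add: diagrams_def)
  have "({1..k} <+> {1..k}) \<inter> ?R = {}"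
    by auto
  then have "\<Union> \<pi> \<inter> \<Union> ((`) ?s ` \<rho>) = {}"
    unfolding partition_onD1[OF L, symmetric] partition_onD1[OF R, symmetric] .
  then have "disjoint (\<pi> \<union> (`) ?s ` \<rho>)"
    by (intro disjoint_union partition_onD2[OF L] partition_onD2[OF R])
  then have "partition_on (({1..k} <+> {1..k}) \<union> ?R) (\<pi> \<union> (`) ?s ` \<rho>)"
    using L R unfolding partition_on_def Union_Un_distrib by simp
  moreover have "({1..k} <+> {1..k}) \<union> ?R = {1..k+l} <+> {1..k+l}"
    by auto
  ultimately show ?thesis
    by (simp add: diagrams_def tensor_def)
qed

lemma finite_compositions: "finite (compositions k)"
proof (rule finite_subset)
  show "compositions k \<subseteq> {\<alpha>. set \<alpha> \<subseteq> {..k} \<and> length \<alpha> \<le> k}"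
  proof
    fix \<alpha> assume \<alpha>: "\<alpha> \<in> compositions k"
    have "length \<alpha> \<le> sum_list \<alpha>" if "\<forall>i \<in> set \<alpha>. 0 < i" for \<alpha> :: "nat list"
      using that by (induction \<alpha>) auto
    then show "\<alpha> \<in> {\<alpha>. set \<alpha> \<subseteq> {..k} \<and> length \<alpha> \<le> k}"
      using \<alpha> member_le_sum_list by (fastforce simp: compositions_def)
  qed
  show "finite {\<alpha>. set \<alpha> \<subseteq> {..k} \<and> length \<alpha> \<le> k}"
    by (rule finite_lists_length_le) simp
qed

end

theory Submission
  imports Defs
begin

text \<open>Cutting a diagram of positive order at its least positive cut splits off its first
  irreducible factor, and the remaining factor is arbitrary. Hence
  \<open>|A\<^sub>k| = (\<Sum>j=1..k. a\<^sub>j * |A\<^sub>k\<^sub>-\<^sub>j|)\<close>. The sum over all compositions of \<open>k\<close>, split by the first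
  part, satisfies the same recurrence, so it equals \<open>|A\<^sub>k| = B\<^sub>2\<^sub>k\<close>; its term for \<open>(k)\<close> is \<open>a\<^sub>k\<close>.\<close>

section \<open>Cuts and factorisations of diagrams\<close>

text \<open>Call \<open>i\<close> and \<open>i'\<close> together column \<open>i\<close>. A cut at
  \<open>m\<close> means that no block joins the first \<open>m\<close> columns to later ones. This
  describes splittings of a diagram without naming the factors, so positions of splittings can be
  compared. Position 0 and the order of the diagram are trivial cuts.\<close>

definition cut :: "nat \<Rightarrow> diagram \<Rightarrow> bool" where
  "cut m \<pi> \<longleftrightarrow> (\<forall>B\<in>\<pi>. B \<subseteq> {1..m} <+> {1..m} \<or> B \<inter> ({1..m} <+> {1..m}) = {})"

abbreviation vertex_shift :: "nat \<Rightarrow> nat + nat \<Rightarrow> nat + nat" where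
  "vertex_shift m \<equiv> map_sum (\<lambda>i. i + m) (\<lambda>i. i + m)"

lemma inj_vertex_shift: "inj (vertex_shift m)"
  by (intro sum.inj_map) (simp_all add: inj_def)

lemma vertex_shift_image: "vertex_shift m ` ({1..n} <+> {1..n}) = {m+1..m+n} <+> {m+1..m+n}"
proof -
  have "(\<lambda>i. i + m) ` {1..n} = {m+1..m+n}"
    by (simp add: add.commute)
  moreover have "vertex_shift m ` ({1..n} <+> {1..n}) = (\<lambda>i. i + m) ` {1..n} <+> (\<lambda>i. i + m) ` {1..n}"
    by (simp only: Plus_def image_Un image_image map_sum.simps)
  ultimately show ?thesis
    by (simp only:)
qed

lemma diagrams_blockD:
  assumes "\<pi> \<in> diagrams k" and "B \<in> \<pi>"
  shows "B \<noteq> {}" and "B \<subseteq> {1..k} <+> {1..k}"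
  using assms by (auto simp: diagrams_def partition_on_def)

text \<open>The blocks cover exactly \<open>2 * k\<close> vertices. This lets the order of a product
  be read off from the orders of its factors.\<close>

lemma diagrams_order_unique:
  assumes "\<pi> \<in> diagrams k" and "\<pi> \<in> diagrams l"
  shows "k = l"
proof -
  have "{1..k} <+> {1..k} = {1..l} <+> {1..l}"
    using assms by (auto simp: diagrams_def partition_on_def)
  then have "card ({1..k} <+> {1..k}) = card ({1..l} <+> {1..l})"
    by simp
  then show ?thesis
    by (simp add: card_Plus)
qed

lemma right_block_disjoint:
  assumes "\<rho> \<in> diagrams n" and "B \<in> \<rho>"
  shows "vertex_shift m ` B \<inter> ({1..m} <+> {1..m}) = {}"
proof -
  have "vertex_shift m ` B \<subseteq> {m+1..m+n} <+> {m+1..m+n}"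
    using diagrams_blockD(2)[OF assms] vertex_shift_image by (metis image_mono)
  then show ?thesis
    by fastforce
qed

text \<open>Recovers the left factor from the product. A shifted block avoids the first
  \<open>m\<close> columns, so, being nonempty, it cannot lie inside them.\<close>

lemma tensor_left_blocks:
  assumes "\<pi> \<in> diagrams m" and "\<rho> \<in> diagrams n"
  shows "{B \<in> tensor m \<pi> \<rho>. B \<subseteq> {1..m} <+> {1..m}} = \<pi>"
proof -
  have "\<not> vertex_shift m ` B \<subseteq> {1..m} <+> {1..m}" if "B \<in> \<rho>" for B
    using right_block_disjoint[OF assms(2) that, of m] diagrams_blockD(1)[OF assms(2) that] by blast
  then show ?thesis
    using diagrams_blockD(2)[OF assms(1)] by (auto simp: tensor_def)
qed

lemma tensor_right_blocks:
  assumes "\<pi> \<in> diagrams m" and "\<rho> \<in> diagrams n"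
  shows "{B \<in> tensor m \<pi> \<rho>. B \<inter> ({1..m} <+> {1..m}) = {}} = (`) (vertex_shift m) ` \<rho>"
proof -
  have "B \<inter> ({1..m} <+> {1..m}) \<noteq> {}" if "B \<in> \<pi>" for B
    using diagrams_blockD[OF assms(1) that] by blast
  then show ?thesis
    using right_block_disjoint[OF assms(2), of _ m] unfolding tensor_def by blast
qed

text \<open>Each factor is recovered from the blocks on its side of column \<open>m\<close>, the
  right one up to the injective shift. Only the order of the left factor has to be known in
  common.\<close>

lemma tensor_inject:
  assumes "\<pi> \<in> diagrams m" "\<rho> \<in> diagrams n" "\<pi>' \<in> diagrams m" "\<rho>' \<in> diagrams n'"
    and "tensor m \<pi> \<rho> = tensor m \<pi>' \<rho>'"
  shows "\<pi> = \<pi>'" and "\<rho> = \<rho>'"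
proof -
  show "\<pi> = \<pi>'"
    using tensor_left_blocks[OF assms(1,2)] tensor_left_blocks[OF assms(3,4)] assms(5) by simp
  have "(`) (vertex_shift m) ` \<rho> = (`) (vertex_shift m) ` \<rho>'"
    using tensor_right_blocks[OF assms(1,2)] tensor_right_blocks[OF assms(3,4)] assms(5) by simp
  then show "\<rho> = \<rho>'"
    using inj_vertex_shift[of m] by (simp add: inj_image_eq_iff inj_on_image)
qed

lemma cut_tensor:
  assumes "\<pi> \<in> diagrams m" and "\<rho> \<in> diagrams n"
  shows "cut m (tensor m \<pi> \<rho>)"
  using diagrams_blockD(2)[OF assms(1)] right_block_disjoint[OF assms(2), of _ m]
  unfolding cut_def tensor_def by blast

text \<open>The blocks inside the first \<open>m\<close> columns form the left factor; the remaining
  ones, shifted back, form the right factor.\<close>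

lemma cut_imp_tensor:
  assumes "\<pi> \<in> diagrams (m + n)" and "cut m \<pi>"
  obtains \<rho>\<^sub>1 \<rho>\<^sub>2 where "\<rho>\<^sub>1 \<in> diagrams m" "\<rho>\<^sub>2 \<in> diagrams n" "\<pi> = tensor m \<rho>\<^sub>1 \<rho>\<^sub>2"
proof -
  let ?L = "{1..m} <+> {1..m}" and ?R = "{m+1..m+n} <+> {m+1..m+n}"
  let ?s = "vertex_shift m"
  define A where "A = {B \<in> \<pi>. B \<subseteq> ?L}"
  define C where "C = {B \<in> \<pi>. B \<inter> ?L = {}}"
  have \<pi>: "partition_on ({1..m+n} <+> {1..m+n}) \<pi>"
    using assms(1) by (simp add: diagrams_def)
  have whole: "{1..m+n} <+> {1..m+n} = ?L \<union> ?R"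
    by auto
  have LR: "?L \<inter> ?R = {}"
    by auto
  have AC: "\<pi> = A \<union> C"
    using assms(2) by (auto simp: A_def C_def cut_def)
  have U: "\<Union>A \<union> \<Union>C = ?L \<union> ?R"
    using partition_onD1[OF \<pi>] unfolding whole AC by blast
  have sub: "\<Union>A \<subseteq> ?L" and disj: "\<Union>C \<inter> ?L = {}"
    unfolding A_def C_def by blast+
  \<comment> \<open>Both unions are identified at once: together they cover two disjoint halves, one
    stays inside the left half and the other avoids it.\<close>
  have split: "X = L \<and> Y = R"
    if "X \<union> Y = L \<union> R" "L \<inter> R = {}" "X \<subseteq> L" "Y \<inter> L = {}" for X Y L R :: "(nat + nat) set"
    using that by blast
  note U_AC = split[OF U LR sub disj]
  have UA: "\<Union>A = ?L" and UC: "\<Union>C = ?R"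
    by (rule conjunct1[OF U_AC], rule conjunct2[OF U_AC])
  have "disjoint A" "disjoint C"
    using partition_onD2[OF \<pi>] by (auto simp: A_def C_def disjoint_def)
  moreover have "{} \<notin> A" "{} \<notin> C"
    using partition_onD3[OF \<pi>] by (auto simp: A_def C_def)
  ultimately have "partition_on ?L A" and pC: "partition_on ?R C"
    using UA UC by (auto simp: partition_on_def)
  then have "A \<in> diagrams m"
    by (simp add: diagrams_def)
  define E where "E = (-`) ?s ` C"
  have "?s -` ?R = {1..n} <+> {1..n}"
    using inj_vertex_shift unfolding vertex_shift_image[symmetric] by (rule inj_vimage_image_eq)
  then have "partition_on ({1..n} <+> {1..n}) (E - {{}})"
    using partition_on_vimage[OF pC, of ?s] by (simp only: E_def)
  \<comment> \<open>Blocks of \<open>C\<close> lie in the range of the shift, so pulling them back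
    loses no vertex. Hence no block of \<open>E\<close> is empty, and removing \<open>{}\<close>
    from \<open>E\<close> changes nothing.\<close>
  moreover have s_E: "?s ` ?s -` B = B" if "B \<in> C" for B
  proof -
    have "B \<subseteq> ?R"
      using UC that by blast
    then have "B \<subseteq> range ?s"
      unfolding vertex_shift_image[symmetric] by blast
    then show ?thesis
      by (simp add: image_vimage_eq Int_absorb2)
  qed
  then have "{} \<notin> E"
    using \<open>{} \<notin> C\<close> unfolding E_def by fastforce
  ultimately have "E \<in> diagrams n"
    by (simp add: diagrams_def)
  moreover have "(`) ?s ` E = C"
    unfolding E_def image_image using s_E by simp
  then have "\<pi> = tensor m A E"
    by (simp add: AC tensor_def)
  ultimately show thesis
    using that \<open>A \<in> diagrams m\<close> by blast
qed

text \<open>A cut at \<open>m < k\<close> yields factors of positive orders \<open>m\<close> and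
  \<open>k - m\<close>. Conversely, a factorisation cuts at the order of its left factor, which is
  below \<open>k\<close> because the orders add up to \<open>k\<close>.\<close>

lemma tensor_irreducible_iff_no_cut:
  assumes "\<pi> \<in> diagrams k"
  shows "tensor_irreducible \<pi> \<longleftrightarrow> (\<forall>m. 0 < m \<and> m < k \<longrightarrow> \<not> cut m \<pi>)"
proof
  assume irr: "tensor_irreducible \<pi>"
  show "\<forall>m. 0 < m \<and> m < k \<longrightarrow> \<not> cut m \<pi>"
  proof (intro allI impI notI)
    fix m assume m: "0 < m \<and> m < k" and "cut m \<pi>"
    moreover have "\<pi> \<in> diagrams (m + (k - m))"
      using assms m by simp
    ultimately obtain \<rho>\<^sub>1 \<rho>\<^sub>2 where
      "\<rho>\<^sub>1 \<in> diagrams m" "\<rho>\<^sub>2 \<in> diagrams (k - m)" "\<pi> = tensor m \<rho>\<^sub>1 \<rho>\<^sub>2"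
      using cut_imp_tensor by blast
    moreover have "0 < k - m"
      using m by simp
    ultimately show False
      using irr m unfolding tensor_irreducible_def by blast
  qed
next
  assume no_cut: "\<forall>m. 0 < m \<and> m < k \<longrightarrow> \<not> cut m \<pi>"
  show "tensor_irreducible \<pi>"
    unfolding tensor_irreducible_def
  proof (intro notI, elim exE conjE)
    fix m n \<rho>\<^sub>1 \<rho>\<^sub>2
    assume mn: "0 < m" "0 < n" and \<rho>: "\<rho>\<^sub>1 \<in> diagrams m" "\<rho>\<^sub>2 \<in> diagrams n"
      and \<pi>: "\<pi> = tensor m \<rho>\<^sub>1 \<rho>\<^sub>2"
    have "k = m + n"
      using diagrams_order_unique[OF assms] tensor_in_diagrams[OF \<rho>] \<pi> by simp
    then show False
      using no_cut mn cut_tensor[OF \<rho>] \<pi> by simp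
  qed
qed

lemma cut_order:
  assumes "\<pi> \<in> diagrams k"
  shows "cut k \<pi>"
  using diagrams_blockD(2)[OF assms] by (auto simp: cut_def)

text \<open>Blocks of the right factor miss the first \<open>m\<close> columns, so they never
  obstruct a cut at or before \<open>m\<close>. This is why minimality of a cut amounts to
  irreducibility of the left factor.\<close>

lemma cut_tensor_left:
  assumes "\<rho> \<in> diagrams n" and "j \<le> m"
  shows "cut j (tensor m \<pi> \<rho>) \<longleftrightarrow> cut j \<pi>"
proof -
  have "{1..j} <+> {1..j} \<subseteq> {1..m} <+> {1..m}"
    using assms(2) by auto
  then have "vertex_shift m ` B \<inter> ({1..j} <+> {1..j}) \<subseteq> vertex_shift m ` B \<inter> ({1..m} <+> {1..m})" for B
    by (rule Int_mono[OF subset_refl])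
  then have "vertex_shift m ` B \<inter> ({1..j} <+> {1..j}) = {}" if "B \<in> \<rho>" for B
    using right_block_disjoint[OF assms(1) that] by (metis subset_empty)
  then show ?thesis
    unfolding cut_def tensor_def by blast
qed

section \<open>Splitting off the first irreducible factor\<close>

definition irreducibles :: "nat \<Rightarrow> diagram set" where
  "irreducibles k = {\<pi> \<in> diagrams k. \<pi> \<noteq> {} \<and> tensor_irreducible \<pi>}"

lemma diagrams_nonempty:
  assumes "\<pi> \<in> diagrams k" and "0 < k"
  shows "\<pi> \<noteq> {}"
  using assms by (auto simp: diagrams_def partition_on_def Plus_def)

lemma irreducibles_iff:
  assumes "0 < k"
  shows "\<pi> \<in> irreducibles k \<longleftrightarrow> \<pi> \<in> diagrams k \<and> (\<forall>m. 0 < m \<and> m < k \<longrightarrow> \<not> cut m \<pi>)"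
  using assms diagrams_nonempty tensor_irreducible_iff_no_cut by (auto simp: irreducibles_def)

text \<open>With an irreducible left factor, \<open>j\<close> must be the least positive cut of the
  product, so the diagram determines \<open>j\<close> and then both factors.\<close>

lemma bij_betw_split_first_irreducible:
  assumes "0 < k"
  shows "bij_betw (\<lambda>(j, \<pi>, \<rho>). tensor j \<pi> \<rho>)
    (SIGMA j:{1..k}. irreducibles j \<times> diagrams (k - j)) (diagrams k)"
proof (rule bij_betwI')
  fix x y
  assume "x \<in> (SIGMA j:{1..k}. irreducibles j \<times> diagrams (k - j))"
    and "y \<in> (SIGMA j:{1..k}. irreducibles j \<times> diagrams (k - j))"
  then obtain i \<pi> \<rho> j \<pi>' \<rho>' where x: "x = (i, \<pi>, \<rho>)" and y: "y = (j, \<pi>', \<rho>')"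
    and pos: "0 < i" "0 < j"
    and irr: "\<pi> \<in> irreducibles i" "\<pi>' \<in> irreducibles j"
    and \<rho>: "\<rho> \<in> diagrams (k - i)" "\<rho>' \<in> diagrams (k - j)"
    by auto
  note \<pi> = irr[unfolded irreducibles_iff[OF pos(1)] irreducibles_iff[OF pos(2)]]
  have "x = y" if eq: "tensor i \<pi> \<rho> = tensor j \<pi>' \<rho>'"
  proof -
    \<comment> \<open>If \<open>i < j\<close>, the common product is cut at \<open>i\<close>, hence
      so is \<open>\<pi>'\<close>, contradicting its irreducibility. The other case is
      symmetric.\<close>
    have "\<not> i < j"
      using cut_tensor[of \<pi> i \<rho>] cut_tensor_left[OF \<rho>(2), of i j \<pi>'] \<pi> \<rho> pos eq by auto
    moreover have "\<not> j < i"
      using cut_tensor[of \<pi>' j \<rho>'] cut_tensor_left[OF \<rho>(1), of j i \<pi>] \<pi> \<rho> pos eq by auto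
    ultimately have "i = j"
      by simp
    then show ?thesis
      using tensor_inject[of \<pi> i \<rho> "k - i" \<pi>' \<rho>' "k - j"] \<pi> \<rho> eq x y by simp
  qed
  then show "((case x of (j, \<pi>, \<rho>) \<Rightarrow> tensor j \<pi> \<rho>) = (case y of (j, \<pi>, \<rho>) \<Rightarrow> tensor j \<pi> \<rho>)) = (x = y)"
    using x y by auto
next
  fix x
  assume "x \<in> (SIGMA j:{1..k}. irreducibles j \<times> diagrams (k - j))"
  then obtain j \<pi> \<rho> where x: "x = (j, \<pi>, \<rho>)" and "j \<le> k"
    and "\<pi> \<in> diagrams j" "\<rho> \<in> diagrams (k - j)"
    by (auto simp: irreducibles_def)
  then show "(case x of (j, \<pi>, \<rho>) \<Rightarrow> tensor j \<pi> \<rho>) \<in> diagrams k"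
    using tensor_in_diagrams[of \<pi> j \<rho> "k - j"] by simp
next
  fix \<pi> assume \<pi>: "\<pi> \<in> diagrams k"
  \<comment> \<open>The least positive cut exists because \<open>k\<close> itself is one. If
    \<open>\<pi>\<close> is irreducible, then \<open>j = k\<close> and the right factor is the empty
    diagram of order 0.\<close>
  define j where "j = (LEAST j. 0 < j \<and> cut j \<pi>)"
  have ex: "0 < k \<and> cut k \<pi>"
    using assms cut_order[OF \<pi>] by simp
  have j: "0 < j \<and> cut j \<pi>"
    unfolding j_def by (rule LeastI, rule ex)
  have "j \<le> k"
    unfolding j_def by (rule Least_le, rule ex)
  have "\<not> cut m \<pi>" if "0 < m" "m < j" for m
    using not_less_Least[of m "\<lambda>j. 0 < j \<and> cut j \<pi>"] that by (simp add: j_def)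
  moreover obtain \<rho>\<^sub>1 \<rho>\<^sub>2 where \<rho>: "\<rho>\<^sub>1 \<in> diagrams j" "\<rho>\<^sub>2 \<in> diagrams (k - j)" "\<pi> = tensor j \<rho>\<^sub>1 \<rho>\<^sub>2"
    using cut_imp_tensor[of \<pi> j "k - j"] \<pi> \<open>j \<le> k\<close> j by auto
  ultimately have "\<rho>\<^sub>1 \<in> irreducibles j"
    using j cut_tensor_left[OF \<rho>(2)] by (simp add: irreducibles_iff)
  then show "\<exists>x\<in>SIGMA j:{1..k}. irreducibles j \<times> diagrams (k - j).
      \<pi> = (case x of (j, \<pi>, \<rho>) \<Rightarrow> tensor j \<pi> \<rho>)"
    using \<rho> j \<open>j \<le> k\<close> by (intro bexI[of _ "(j, \<rho>\<^sub>1, \<rho>\<^sub>2)"]) auto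
qed

lemma card_diagrams_rec:
  assumes "0 < k"
  shows "card (diagrams k) = (\<Sum>j=1..k. num_irreducible j * card (diagrams (k - j)))"
proof -
  have "finite (irreducibles j)" for j
    using finite_diagrams by (simp add: irreducibles_def)
  moreover have "card (diagrams k) = card (SIGMA j:{1..k}. irreducibles j \<times> diagrams (k - j))"
    using bij_betw_same_card[OF bij_betw_split_first_irreducible[OF assms]] by simp
  ultimately show ?thesis
    by (simp add: card_cartesian_product finite_diagrams num_irreducible_def irreducibles_def)
qed

section \<open>Compositions and their recurrence\<close>

lemma compositions_0: "compositions 0 = {[]}"
proof -
  have "\<alpha> = []" if "\<alpha> \<in> compositions 0" for \<alpha>
    using that by (cases \<alpha>) (auto simp: compositions_def)
  then show ?thesis
    by (auto simp: compositions_def)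
qed

text \<open>Positivity of \<open>k\<close> excludes the empty list, so a first part can be removed.
  The tail is empty exactly when that part is \<open>k\<close>.\<close>

lemma bij_betw_compositions:
  assumes "0 < k"
  shows "bij_betw (\<lambda>(j, \<alpha>). j # \<alpha>) (SIGMA j:{1..k}. compositions (k - j)) (compositions k)"
proof (rule bij_betwI')
  fix \<alpha> assume "\<alpha> \<in> compositions k"
  then show "\<exists>x\<in>SIGMA j:{1..k}. compositions (k - j). \<alpha> = (case x of (j, \<alpha>) \<Rightarrow> j # \<alpha>)"
    using assms by (cases \<alpha>) (auto simp: compositions_def)
qed (auto simp: compositions_def)

lemma sum_compositions_rec:
  fixes a :: "nat \<Rightarrow> 'a::comm_semiring_1"
  assumes "0 < k"
  shows "(\<Sum>\<alpha>\<in>compositions k. prod_list (map a \<alpha>)) =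
    (\<Sum>j=1..k. a j * (\<Sum>\<alpha>\<in>compositions (k - j). prod_list (map a \<alpha>)))"
proof -
  have "(\<Sum>\<alpha>\<in>compositions k. prod_list (map a \<alpha>)) =
      (\<Sum>(j, \<alpha>)\<in>(SIGMA j:{1..k}. compositions (k - j)). a j * prod_list (map a \<alpha>))"
    unfolding sum.reindex_bij_betw[OF bij_betw_compositions[OF assms], symmetric]
    by (intro sum.cong) auto
  then show ?thesis
    by (simp add: sum.Sigma[symmetric] finite_compositions sum_distrib_left)
qed

lemma card_diagrams_eq_sum_compositions:
  "card (diagrams k) = (\<Sum>\<alpha>\<in>compositions k. prod_list (map num_irreducible \<alpha>))"
proof (induction k rule: less_induct)
  case (less k)
  show ?case
  proof (cases "k = 0")
    case True
    then show ?thesis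
      \<comment> \<open>Both sides are 1: there is one diagram of order 0, and the empty composition
        contributes the empty product.\<close>
      by (simp add: diagrams_0 compositions_0)
  next
    case False
    then have "0 < k"
      by simp
    show ?thesis
      unfolding card_diagrams_rec[OF \<open>0 < k\<close>] sum_compositions_rec[OF \<open>0 < k\<close>]
      \<comment> \<open>The summation index \<open>j\<close> starts at 1, so
        \<open>k - j < k\<close> and the induction hypothesis applies to every term.\<close>
      using \<open>0 < k\<close> less by (intro sum.cong) auto
  qed
qed

section \<open>Bell numbers and the final formula\<close>

text \<open>One inequality suffices, since the inverse bijection supplies the other. Injectivity of
  \<open>f\<close> is lifted twice, from points to blocks and from blocks to families of
  blocks.\<close>

lemma card_partitions_le:
  assumes "bij_betw f A B" and "finite B"
  shows "card {P. partition_on A P} \<le> card {P. partition_on B P}"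
proof (rule card_inj_on_le)
  have f: "inj_on f A" "f ` A = B"
    using assms(1) by (auto simp: bij_betw_def)
  have "inj_on ((`) f) (Pow A)"
    using f(1) by (simp add: inj_on_image_Pow)
  then have "inj_on ((`) ((`) f)) (Pow (Pow A))"
    by (rule inj_on_image_Pow)
  then show "inj_on ((`) ((`) f)) {P. partition_on A P}"
    by (rule inj_on_subset) (auto simp: partition_on_def)
  have "partition_on B ((`) f ` P)" if "partition_on A P" for P
  proof -
    have "{} \<notin> (`) f ` P"
      using partition_onD3[OF that] by auto
    then show ?thesis
      using partition_on_inj_image[OF that f(1)] f(2) by simp
  qed
  then show "(`) ((`) f) ` {P. partition_on A P} \<subseteq> {P. partition_on B P}"
    by blast
  show "finite {P. partition_on B P}"
    using assms(2) by (rule finitely_many_partition_on)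
qed

lemma card_diagrams: "card (diagrams k) = Bell (2 * k)"
proof -
  have "card ({1..k} <+> {1..k}) = card {1..2 * k}"
    by (simp add: card_Plus)
  then obtain f where f: "bij_betw f ({1..k} <+> {1..k}) {1..2 * k}"
    using finite_same_card_bij[of "{1..k} <+> {1..k}" "{1..2 * k}"] by auto
  show ?thesis
    unfolding diagrams_def Bell_def
    using card_partitions_le[OF f] card_partitions_le[OF bij_betw_inv_into[OF f]]
    by (intro antisym) simp_all
qed

lemma Bell_2: "Bell 2 = 2"
proof -
  have "{1..2} = {1, 2::nat}"
    by auto
  moreover have "partition_on {1, 2::nat} P \<longleftrightarrow> P = {{1, 2}} \<or> P = {{1}, {2}}" for P
  proof
    assume P: "partition_on {1, 2} P"
    have "B = {1} \<or> B = {2} \<or> B = {1, 2}" if "B \<in> P" for B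
    proof -
      have "B \<subseteq> {1, 2}" "B \<noteq> {}"
        using P that by (auto simp: partition_on_def)
      then show ?thesis
        by blast
    qed
    then have sub: "P \<subseteq> {{1}, {2}, {1, 2}}"
      by blast
    have disj: "B = C" if "B \<in> P" "C \<in> P" "x \<in> B" "x \<in> C" for B C x
      using partition_onD2[OF P] that by (auto simp: disjoint_def)
    show "P = {{1, 2}} \<or> P = {{1}, {2}}"
    proof (cases "{1, 2} \<in> P")
      case True
      then have "{1} \<notin> P" "{2} \<notin> P"
        using disj[of "{1, 2}" "{1}" 1] disj[of "{1, 2}" "{2}" 2] by auto
      with True sub show ?thesis
        by auto
    next
      case False
      moreover have "1 \<in> \<Union>P" "2 \<in> \<Union>P"
        unfolding partition_onD1[OF P, symmetric] by simp_all
      ultimately have "{1} \<in> P" "{2} \<in> P"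
        using sub by auto
      with False sub show ?thesis
        by auto
    qed
  next
    assume "P = {{1, 2}} \<or> P = {{1}, {2}}"
    then show "partition_on {1, 2} P"
      by (elim disjE) (simp_all add: partition_on_def disjoint_def insert_commute)
  qed
  moreover have "{{1, 2}} \<noteq> {{1}, {2::nat}}"
    by auto
  ultimately show ?thesis
    by (simp add: Bell_def Collect_disj_eq)
qed

theorem theorem2p5:
  shows "num_irreducible 1 = 2 \<and>
    (\<forall>k\<ge>1. int (num_irreducible k) =
      int (Bell (2 * k)) -
        (\<Sum>\<alpha> \<in> compositions k - {[k]}. prod_list (map (\<lambda>i. int (num_irreducible i)) \<alpha>)))"
proof (intro conjI allI impI)
  \<comment> \<open>For \<open>k = 1\<close> the recurrence has the single term
    \<open>j = 1\<close>, whose second factor counts the one diagram of order 0.\<close>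
  have "card (diagrams 1) = num_irreducible 1"
    using card_diagrams_rec[of 1] by (simp add: diagrams_0)
  then show "num_irreducible 1 = 2"
    using card_diagrams[of 1] Bell_2 by simp
next
  fix k :: nat assume "1 \<le> k"
  then have "[k] \<in> compositions k"
    by (simp add: compositions_def)
  \<comment> \<open>The term of \<open>[k]\<close> is isolated first as an addition of natural
    numbers; the subtraction is then carried out in the integers, where it is not truncated.\<close>
  then have "Bell (2 * k) = num_irreducible k +
      (\<Sum>\<alpha>\<in>compositions k - {[k]}. prod_list (map num_irreducible \<alpha>))"
    using card_diagrams_eq_sum_compositions[of k] finite_compositions
    by (simp add: card_diagrams sum.remove)
  moreover have "int (prod_list (map num_irreducible \<alpha>)) =
      prod_list (map (\<lambda>i. int (num_irreducible i)) \<alpha>)" for \<alpha>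
    by (induction \<alpha>) simp_all
  ultimately show "int (num_irreducible k) = int (Bell (2 * k)) -
      (\<Sum>\<alpha>\<in>compositions k - {[k]}. prod_list (map (\<lambda>i. int (num_irreducible i)) \<alpha>))"
    by simp
qed

end
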